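(* Let $0=\lambda_1<\lambda_2\le\cdots\le\lambda_N$ be the eigenvalues of the combinatorial Laplacian of a fixed connected undirected weighted graph and let $D>0$. Fix $T>0$, $K_{\max}>0$ and $S_T\ge0$ with $S_T\le K_{\max}T$, and consider the admissible class of measurable schedules $K:[0,T]\to\mathbb R$ with $$0\le K(t)\le K_{\max},\qquad \int_0^TK(t)\,\mathrm dt=S_T .$$ For each $\alpha\in\{2,\dots,N\}$, with fixed initial variance $v_\alpha(0)\ge0$, let $v_\alpha(T)$ be the terminal variance of the mode $c_\alpha$ driven by the schedule $K$. Then every $v_\alpha(T)$, $\alpha=2,\dots,N$, is minimized over the admissible class by the terminal bang--bang schedule $$K_*(t)=\begin{cases}0,&0\le t<T-S_T/K_{\max},\\ K_{\max},&T-S_T/K_{\max}<t\le T.\end{cases}$$ The same schedule minimizes any nonnegative weighted sum of the mode variances $v_\alpha(T)$.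
   Context: For a schedule $K$, the mode $c_\alpha$ is the solution of $\mathrm dc_\alpha=-\lambda_\alpha K(t)c_\alpha\,\mathrm dt+\sqrt{2D}\,\mathrm dW_{\alpha,t}$ on $[0,T]$, where $W_\alpha$ is a standard one-dimensional Brownian motion and $c_\alpha(0)$ is square integrable and independent of $W_\alpha$. Its variance $v_\alpha(t)=\operatorname{Var}[c_\alpha(t)]$ satisfies $$v_\alpha(T)=v_\alpha(0)\mathrm e^{-2\lambda_\alpha S(T)}+2D\int_0^T\mathrm e^{-2\lambda_\alpha[S(T)-S(u)]}\,\mathrm du,\qquad S(u)=\int_0^uK(r)\,\mathrm dr.$$ The initial variances $v_\alpha(0)$ do not depend on the schedule. *)

theory Defs
  imports "HOL-Probability.Probability" "Jordan_Normal_Form.Char_Poly"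
begin

text \<open>A weighted graph on the vertices \<open>0, \<dots>, N - 1\<close> is given by its weight function \<open>w\<close>;
  \<open>i\<close> and \<open>j\<close> are adjacent iff \<open>w i j > 0\<close>.\<close>

definition weighted_graph :: "nat \<Rightarrow> (nat \<Rightarrow> nat \<Rightarrow> real) \<Rightarrow> bool" where
  "weighted_graph N w \<longleftrightarrow>
     (\<forall>i<N. \<forall>j<N. 0 \<le> w i j \<and> w i j = w j i) \<and> (\<forall>i<N. w i i = 0)"

definition graph_edges :: "nat \<Rightarrow> (nat \<Rightarrow> nat \<Rightarrow> real) \<Rightarrow> (nat \<times> nat) set" where
  "graph_edges N w = {(i, j). i < N \<and> j < N \<and> 0 < w i j}"

definition connected_graph :: "nat \<Rightarrow> (nat \<Rightarrow> nat \<Rightarrow> real) \<Rightarrow> bool" where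
  "connected_graph N w \<longleftrightarrow> 0 < N \<and> (\<forall>i<N. \<forall>j<N. (i, j) \<in> (graph_edges N w)\<^sup>*)"

definition laplacian :: "nat \<Rightarrow> (nat \<Rightarrow> nat \<Rightarrow> real) \<Rightarrow> real mat" where
  "laplacian N w = mat N N (\<lambda>(i, j). if i = j then (\<Sum>k<N. w i k) else - w i j)"

text \<open>\<open>lam 1, \<dots>, lam N\<close> lists the eigenvalues with multiplicity, in nondecreasing order.\<close>

definition eigenvalue_list :: "nat \<Rightarrow> real mat \<Rightarrow> (nat \<Rightarrow> real) \<Rightarrow> bool" where
  "eigenvalue_list N A lam \<longleftrightarrow>
     char_poly A = (\<Prod>\<alpha>=1..N. [:- lam \<alpha>, 1:]) \<and> mono_on {1..N} lam"

text \<open>Standard one-dimensional Brownian motion on the time interval \<open>[0, T]\<close>.\<close>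

locale brownian_motion = prob_space M for M :: "'a measure" +
  fixes T :: real and W :: "real \<Rightarrow> 'a \<Rightarrow> real"
  assumes measurable_W: "\<And>t. t \<in> {0..T} \<Longrightarrow> random_variable borel (W t)"
    and start_W: "AE \<omega> in M. W 0 \<omega> = 0"
    and normal_increments: "\<And>s t. 0 \<le> s \<Longrightarrow> s < t \<Longrightarrow> t \<le> T \<Longrightarrow>
      distributed M lborel (\<lambda>\<omega>. W t \<omega> - W s \<omega>) (normal_density 0 (sqrt (t - s)))"
    and indep_increments: "\<And>(n::nat) (t::nat \<Rightarrow> real).
      (\<forall>i\<le>n. t i \<in> {0..T}) \<Longrightarrow> (\<forall>i<n. t i < t (Suc i)) \<Longrightarrow>
      indep_vars (\<lambda>_. borel) (\<lambda>i \<omega>. W (t (Suc i)) \<omega> - W (t i) \<omega>) {..<n}"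
    and continuous_W: "AE \<omega> in M. continuous_on {0..T} (\<lambda>t. W t \<omega>)"

text \<open>A solution \<open>c\<close> of \<open>dc = - l K(t) c dt + sqrt (2 D) dW\<close> on \<open>[0, T]\<close>. As the noise is
  additive, the stochastic integral in the integrated equation is just \<open>sqrt (2 D) W(t)\<close>.
  Independence of \<open>c(0)\<close> and \<open>W\<close> refers to the whole path of \<open>W\<close> on \<open>[0, T]\<close>.\<close>

locale driven_mode = brownian_motion M T W
  for M :: "'a measure" and T :: real and W :: "real \<Rightarrow> 'a \<Rightarrow> real" +
  fixes D :: real and l :: real and K :: "real \<Rightarrow> real" and c :: "real \<Rightarrow> 'a \<Rightarrow> real"
  assumes measurable_c: "\<And>t. t \<in> {0..T} \<Longrightarrow> random_variable borel (c t)"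
    and square_integrable_start: "integrable M (\<lambda>\<omega>. (c 0 \<omega>)\<^sup>2)"
    and indep_start: "indep_set (sets (vimage_algebra (space M) (c 0) borel))
      (sets (vimage_algebra (space M) (\<lambda>\<omega>. \<lambda>t\<in>{0..T}. W t \<omega>) (Pi\<^sub>M {0..T} (\<lambda>_. borel))))"
    and continuous_c: "AE \<omega> in M. continuous_on {0..T} (\<lambda>t. c t \<omega>)"
    and solution: "AE \<omega> in M. \<forall>t\<in>{0..T}.
      c t \<omega> = c 0 \<omega> - l * (\<integral>s. K s * c s \<omega> \<partial>lebesgue_on {0..t}) + sqrt (2 * D) * W t \<omega>"

definition admissible :: "real \<Rightarrow> real \<Rightarrow> real \<Rightarrow> (real \<Rightarrow> real) \<Rightarrow> bool" where
  "admissible T Kmax S\<^sub>T K \<longleftrightarrow>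
     K \<in> borel_measurable (lebesgue_on {0..T}) \<and>
     (\<forall>t\<in>{0..T}. 0 \<le> K t \<and> K t \<le> Kmax) \<and>
     (\<integral>t. K t \<partial>lebesgue_on {0..T}) = S\<^sub>T"

text \<open>The value \<open>\<kappa>\<close> at the switching time is a parameter, since the schedule is specified only
  away from that time.\<close>

definition terminal_bang_bang :: "real \<Rightarrow> real \<Rightarrow> real \<Rightarrow> real \<Rightarrow> real \<Rightarrow> real" where
  "terminal_bang_bang T Kmax S\<^sub>T \<kappa> t =
     (if t < T - S\<^sub>T / Kmax then 0 else if t = T - S\<^sub>T / Kmax then \<kappa> else Kmax)"

end

theory Submission
  imports Defs
begin

text \<open>
  With \<open>g t = exp (- \<lambda> \<integral>\<^sub>t\<^sup>T K)\<close>, telescoping \<open>g c\<close> along the uniform partitions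
  \<open>t\<^sub>k\<close> of \<open>[0, T]\<close> shows that, on every continuous path, the sums
  \<open>\<Sum>\<^sub>k g t\<^sub>k sqrt (2 D) (W t\<^sub>k\<^sub>+\<^sub>1 - W t\<^sub>k)\<close> converge to \<open>c T - g 0 c 0\<close>; neither a
  stochastic integral nor joint measurability of \<open>W\<close> is needed. The sums are centred normal with
  variances tending to \<open>2 D \<integral> g\<^sup>2\<close>, hence so is their limit (characteristic functions), and the
  limit is a function of the path of \<open>W\<close>, hence independent of \<open>c 0\<close>. Therefore
  \<open>Var (c T) = (g 0)\<^sup>2 Var (c 0) + 2 D \<integral> g\<^sup>2\<close>. All admissible schedules share
  \<open>g 0 = exp (- \<lambda> S\<^sub>T)\<close>, and the terminal bang-bang schedule maximizes \<open>\<integral>\<^sub>t\<^sup>T K\<close> for every \<open>t\<close>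
  at once, i.e. minimizes \<open>g\<close> pointwise.
\<close>

section \<open>Relaxation along a path\<close>

text \<open>The index \<open>m\<close> gives \<open>Suc m\<close> cells, so the cell length
  \<open>T / real (Suc m)\<close> is meaningful for every \<open>m\<close>.\<close>

definition node :: "real \<Rightarrow> nat \<Rightarrow> nat \<Rightarrow> real" where
  "node T m k = T * real k / real (Suc m)"

lemma node_0 [simp]: "node T m 0 = 0"
  and node_last [simp]: "node T m (Suc m) = T"
  by (simp_all add: node_def)

lemma node_Suc: "node T m (Suc k) = node T m k + T / real (Suc m)"
  by (simp add: node_def distrib_left add_divide_distrib)

lemma node_in:
  assumes "0 \<le> T" "k \<le> Suc m"
  shows "node T m k \<in> {0..T}"
proof -
  have "real k \<le> real (Suc m)" using assms by (simp only: of_nat_le_iff)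
  with assms show ?thesis
    by (auto simp: node_def divide_le_eq intro: mult_left_mono simp del: of_nat_Suc)
qed

lemma sum_node_increments: "(\<Sum>k<Suc m. F (node T m (Suc k)) - F (node T m k)) = F T - (F 0 :: real)"
  using sum_lessThan_telescope[of "\<lambda>k. F (node T m k)" "Suc m"] by simp

section \<open>Riemann sums of monotone functions\<close>

lemma integral_diff_initial:
  fixes f :: "real \<Rightarrow> real"
  assumes "f integrable_on {0..T}" "0 \<le> a" "a \<le> b" "b \<le> T"
  shows "integral {0..b} f - integral {0..a} f = integral {a..b} f"
proof -
  have "f integrable_on {0..b}"
    using assms by (intro integrable_subinterval_real[OF assms(1)]) auto
  from Henstock_Kurzweil_Integration.integral_combine[OF assms(2,3) this] show ?thesis by simp
qed

text \<open>Monotonicity traps the integral between the left and the right Riemann sum, whose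
  difference telescopes to the cell length times \<open>f T - f 0\<close>. Applied to the square of
  \<open>decay\<close>, this identifies the limit of the noise variances.\<close>

lemma riemann_sum_mono_tendsto:
  fixes f :: "real \<Rightarrow> real"
  assumes T: "0 \<le> T" and mono: "mono_on {0..T} f" and int: "f integrable_on {0..T}"
  shows "(\<lambda>m. \<Sum>k<Suc m. f (node T m k) * (T / real (Suc m))) \<longlonglongrightarrow> integral {0..T} f"
proof (rule LIM_zero_cancel, rule Lim_null_comparison)
  show "(\<lambda>m. T / real (Suc m) * (f T - f 0)) \<longlonglongrightarrow> 0"
    by (intro tendsto_mult_left_zero LIMSEQ_Suc lim_const_over_n)
  show "\<forall>\<^sub>F m in sequentially. norm ((\<Sum>k<Suc m. f (node T m k) * (T / real (Suc m))) - integral {0..T} f)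
      \<le> T / real (Suc m) * (f T - f 0)"
  proof (rule always_eventually, rule allI)
    fix m
    define h where "h = T / real (Suc m)"
    have h0: "0 \<le> h" using T by (simp add: h_def)
    define I where "I k = integral {node T m k..node T m (Suc k)} f" for k
    have bounds: "f (node T m k) * h \<le> I k \<and> I k \<le> f (node T m (Suc k)) * h" if k: "k < Suc m" for k
    proof -
      have kn: "node T m k \<in> {0..T}" "node T m (Suc k) \<in> {0..T}"
        using k T node_in[of T k m] node_in[of T "Suc k" m] by simp_all
      have le: "node T m k \<le> node T m (Suc k)" using h0 by (simp add: node_Suc h_def)
      have "f integrable_on {node T m k..node T m (Suc k)}"
        using kn by (intro integrable_subinterval_real[OF int]) auto
      then have fi: "(f has_integral I k) {node T m k..node T m (Suc k)}"
        by (simp add: I_def has_integral_integral[symmetric])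
      have c: "((\<lambda>_. y) has_integral y * h) {node T m k..node T m (Suc k)}" for y :: real
        using has_integral_const_real[of y "node T m k" "node T m (Suc k)"] le h0
        by (simp add: node_Suc h_def mult.commute)
      have "f (node T m k) * h \<le> I k"
        by (rule has_integral_le[OF c fi]) (use kn in \<open>auto intro!: mono_onD[OF mono]\<close>)
      moreover have "I k \<le> f (node T m (Suc k)) * h"
        by (rule has_integral_le[OF fi c]) (use kn in \<open>auto intro!: mono_onD[OF mono]\<close>)
      ultimately show ?thesis by simp
    qed
    have "I k = integral {0..node T m (Suc k)} f - integral {0..node T m k} f" if "k < Suc m" for k
      unfolding I_def using that T h0 node_in[of T k m] node_in[of T "Suc k" m]
      by (intro integral_diff_initial[OF int, symmetric]) (auto simp: node_Suc h_def)
    then have "(\<Sum>k<Suc m. I k)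
        = (\<Sum>k<Suc m. integral {0..node T m (Suc k)} f - integral {0..node T m k} f)"
      by (intro sum.cong) auto
    also have "\<dots> = integral {0..T} f" by (subst sum_node_increments) simp
    finally have I: "(\<Sum>k<Suc m. I k) = integral {0..T} f" .
    have lo: "(\<Sum>k<Suc m. f (node T m k) * h) \<le> (\<Sum>k<Suc m. I k)"
      by (rule sum_mono) (use bounds in auto)
    have "(\<Sum>k<Suc m. I k) \<le> (\<Sum>k<Suc m. f (node T m (Suc k)) * h)"
      by (rule sum_mono) (use bounds in auto)
    also have "\<dots> = (\<Sum>k<Suc m. f (node T m k) * h)
        + (\<Sum>k<Suc m. f (node T m (Suc k)) - f (node T m k)) * h"
      by (simp add: sum_subtractf left_diff_distrib sum_distrib_right del: sum.lessThan_Suc)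
    finally have "(\<Sum>k<Suc m. I k) \<le> (\<Sum>k<Suc m. f (node T m k) * h) + h * (f T - f 0)"
      by (simp only: sum_node_increments mult.commute)
    with lo show "norm ((\<Sum>k<Suc m. f (node T m k) * (T / real (Suc m))) - integral {0..T} f)
        \<le> T / real (Suc m) * (f T - f 0)"
      unfolding I h_def[symmetric] by simp
  qed
qed

text \<open>Multiplying \<open>1 - x \<le> exp (- x)\<close> by \<open>exp x\<close> gives
  \<open>exp x - 1 \<le> x * exp x\<close>; using this bound twice makes the remainder
  quadratic.\<close>

lemma exp_remainder_bound:
  fixes x :: real
  assumes "0 \<le> x"
  shows "\<bar>exp x - 1 - x\<bar> \<le> x\<^sup>2 * exp x"
proof -
  have "1 + (- x) \<le> exp (- x)" by (rule exp_ge_add_one_self)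
  then have "(1 - x) * exp x \<le> exp (- x) * exp x" by (intro mult_right_mono) auto
  then have *: "exp x - 1 \<le> x * exp x" by (simp add: mult_exp_exp algebra_simps)
  then have "x * (exp x - 1) \<le> x * (x * exp x)" using assms by (intro mult_left_mono)
  with * have "exp x - 1 - x \<le> x\<^sup>2 * exp x" by (simp add: power2_eq_square algebra_simps)
  then show ?thesis using exp_ge_add_one_self[of x] by linarith
qed

section \<open>The integrating factor of a bounded schedule\<close>

locale bounded_schedule =
  fixes T Kmax l :: real and K :: "real \<Rightarrow> real"
  assumes T_pos: "0 < T" and l_nonneg: "0 \<le> l"
    and K_integrable: "K integrable_on {0..T}"
    and K_nonneg: "\<And>t. t \<in> {0..T} \<Longrightarrow> 0 \<le> K t"
    and K_le: "\<And>t. t \<in> {0..T} \<Longrightarrow> K t \<le> Kmax"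
begin

text \<open>The integrating factor of the mode equation, normalized to 1 at \<open>T\<close>: the
  fraction of a disturbance at time \<open>t\<close> that survives until \<open>T\<close>.\<close>

definition decay :: "real \<Rightarrow> real" where
  "decay t = exp (- (l * integral {t..T} K))"

lemma K_integrable_sub: "0 \<le> a \<Longrightarrow> b \<le> T \<Longrightarrow> K integrable_on {a..b}"
  by (rule integrable_subinterval_real[OF K_integrable]) auto

lemma integral_K_nonneg: "0 \<le> a \<Longrightarrow> b \<le> T \<Longrightarrow> 0 \<le> integral {a..b} K"
  by (rule integral_nonneg[OF K_integrable_sub]) (auto intro: K_nonneg)

lemma integral_K_le:
  assumes "0 \<le> a" "a \<le> b" "b \<le> T"
  shows "integral {a..b} K \<le> Kmax * (b - a)"
proof -
  have "integral {a..b} K \<le> integral {a..b} (\<lambda>_. Kmax)"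
    using assms by (intro integral_le K_integrable_sub) (auto intro: K_le)
  with assms show ?thesis by (simp add: mult.commute)
qed

lemma Kmax_nonneg: "0 \<le> Kmax"
  using K_nonneg[of 0] K_le[of 0] T_pos by auto

lemma decay_step:
  assumes "0 \<le> a" "a \<le> b" "b \<le> T"
  shows "decay b = decay a * exp (l * integral {a..b} K)"
proof -
  have "integral {a..b} K + integral {b..T} K = integral {a..T} K"
    using assms by (intro Henstock_Kurzweil_Integration.integral_combine K_integrable_sub) auto
  then have "- (l * integral {b..T} K) = - (l * integral {a..T} K) + l * integral {a..b} K"
    by (simp add: algebra_simps flip: distrib_left)
  then show ?thesis by (simp only: decay_def exp_add)
qed

lemma decay_pos: "0 < decay t"
  by (simp add: decay_def)

lemma decay_end [simp]: "decay T = 1"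
  by (simp add: decay_def)

lemma decay_mono: "0 \<le> a \<Longrightarrow> a \<le> b \<Longrightarrow> b \<le> T \<Longrightarrow> decay a \<le> decay b"
  using decay_step[of a b] integral_K_nonneg[of a b] l_nonneg decay_pos[of a] by simp

lemma decay_le_1: "0 \<le> t \<Longrightarrow> t \<le> T \<Longrightarrow> decay t \<le> 1"
  using decay_mono[of t T] by simp

lemma continuous_on_decay: "continuous_on {0..T} decay"
  unfolding decay_def
  by (intro continuous_intros indefinite_integral_continuous_1' K_integrable)

text \<open>The ratio of \<open>decay b\<close> to \<open>decay a\<close> is \<open>exp x\<close>
  with \<open>x = l * integral {a..b} K\<close>, so the error is an exponential remainder at some
  \<open>x \<le> l * Kmax * (b - a)\<close>. This stands in for differentiating
  \<open>decay\<close>, which can fail where \<open>K\<close> jumps.\<close>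

lemma decay_step_error:
  assumes "0 \<le> a" "a \<le> b" "b \<le> T"
  shows "\<bar>decay a * (l * integral {a..b} K) - (decay b - decay a)\<bar>
    \<le> (l * Kmax * (b - a))\<^sup>2 * exp (l * Kmax * T)"
proof -
  define x where "x = l * integral {a..b} K"
  have x0: "0 \<le> x" using assms l_nonneg integral_K_nonneg[of a b] by (simp add: x_def)
  have x1: "x \<le> l * Kmax * (b - a)"
    unfolding x_def mult.assoc by (intro mult_left_mono integral_K_le assms l_nonneg)
  also have "\<dots> \<le> l * Kmax * T"
    using assms by (intro mult_left_mono) (auto simp: l_nonneg Kmax_nonneg)
  finally have x2: "x \<le> l * Kmax * T" .
  have "decay a * x - (decay b - decay a) = - (decay a * (exp x - 1 - x))"
    using decay_step[OF assms] by (simp add: x_def algebra_simps)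
  then have "\<bar>decay a * x - (decay b - decay a)\<bar> = decay a * \<bar>exp x - 1 - x\<bar>"
    using decay_pos[of a] by (simp add: abs_mult)
  also have "\<dots> \<le> 1 * (x\<^sup>2 * exp x)"
    using assms decay_pos[of a] by (intro mult_mono exp_remainder_bound x0 decay_le_1) auto
  also have "\<dots> \<le> (l * Kmax * (b - a))\<^sup>2 * exp (l * Kmax * T)"
    using x0 x1 x2 by (auto intro!: mult_mono power_mono)
  finally show ?thesis by (simp add: x_def)
qed

text \<open>A discrete product rule for \<open>decay * c\<close>: the drift and the increment of
  \<open>decay\<close> cancel to first order. The two error terms come from the oscillation of
  \<open>c\<close> and from the linearization of \<open>decay\<close>.\<close>

lemma solution_step_error:
  fixes c W :: "real \<Rightarrow> real"
  assumes sol: "\<And>t. t \<in> {0..T} \<Longrightarrow> c t = c 0 - l * integral {0..t} (\<lambda>s. K s * c s) + \<sigma> * W t"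
    and Kc: "(\<lambda>s. K s * c s) integrable_on {0..T}"
    and ab: "0 \<le> a" "a \<le> b" "b \<le> T"
    and osc: "\<And>s. s \<in> {a..b} \<Longrightarrow> \<bar>c s - c b\<bar> \<le> e"
    and bound: "\<bar>c b\<bar> \<le> C" and e: "0 \<le> e"
  shows "\<bar>decay a * (\<sigma> * (W b - W a)) - (decay b * c b - decay a * c a)\<bar>
    \<le> l * Kmax * e * (b - a) + C * ((l * Kmax * (b - a))\<^sup>2 * exp (l * Kmax * T))"
proof -
  have Kcab: "(\<lambda>s. K s * c s) integrable_on {a..b}"
    using ab by (intro integrable_subinterval_real[OF Kc]) auto
  have Kab: "K integrable_on {a..b}" using ab by (intro K_integrable_sub) auto
  have W: "\<sigma> * (W b - W a) = c b - c a + l * integral {a..b} (\<lambda>s. K s * c s)"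
    using sol[of a] sol[of b] ab
    by (simp add: integral_diff_initial[OF Kc ab, symmetric] algebra_simps)
  \<comment> \<open>Freezing \<open>c\<close> at the right endpoint lets the drift pair with the
    last term of \<open>decay b * c b - decay a * c a = decay a * (c b - c a) + (decay b - decay a)
    * c b\<close>.\<close>
  define R where "R = integral {a..b} (\<lambda>s. K s * (c s - c b))"
  have "integral {a..b} (\<lambda>s. K s * c s) - integral {a..b} (\<lambda>s. K s * c b) = R"
    unfolding R_def
    by (subst Henstock_Kurzweil_Integration.integral_diff[symmetric])
      (auto intro!: Kcab integrable_on_mult_left Kab simp: algebra_simps)
  then have R: "integral {a..b} (\<lambda>s. K s * c s) = R + integral {a..b} K * c b" by simp
  have "norm R \<le> integral {a..b} (\<lambda>s. Kmax * e)"
    unfolding R_def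
  proof (rule integral_norm_bound_integral)
    have "(\<lambda>s. K s * c s - K s * c b) integrable_on {a..b}"
      by (intro Henstock_Kurzweil_Integration.integrable_diff Kcab integrable_on_mult_left Kab)
    then show "(\<lambda>s. K s * (c s - c b)) integrable_on {a..b}" by (simp add: algebra_simps)
    show "norm (K s * (c s - c b)) \<le> Kmax * e" if "s \<in> {a..b}" for s
    proof -
      have "s \<in> {0..T}" using that ab by auto
      then show ?thesis using K_nonneg[of s] K_le[of s] osc[OF that] e
        by (auto simp: abs_mult intro!: mult_mono)
    qed
  qed auto
  then have R_le: "\<bar>R\<bar> \<le> Kmax * e * (b - a)" using ab by (simp add: mult_ac)
  have "decay a * (\<sigma> * (W b - W a)) - (decay b * c b - decay a * c a)
     = decay a * l * R + c b * (decay a * (l * integral {a..b} K) - (decay b - decay a))"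
    unfolding W R by (simp add: algebra_simps)
  also have "\<bar>\<dots>\<bar> \<le> \<bar>decay a * l * R\<bar>
      + \<bar>c b * (decay a * (l * integral {a..b} K) - (decay b - decay a))\<bar>"
    by (rule abs_triangle_ineq)
  also have "\<bar>decay a * l * R\<bar> \<le> 1 * l * (Kmax * e * (b - a))"
    unfolding abs_mult using ab l_nonneg decay_pos[of a] decay_le_1[of a] R_le
    by (intro mult_mono) auto
  also have "\<bar>c b * (decay a * (l * integral {a..b} K) - (decay b - decay a))\<bar>
      \<le> C * ((l * Kmax * (b - a))\<^sup>2 * exp (l * Kmax * T))"
    unfolding abs_mult[of "c b"] using bound
    by (intro mult_mono decay_step_error ab) auto
  finally show ?thesis by (simp add: algebra_simps)
qed

text \<open>Over \<open>Suc m\<close> cells of length \<open>h\<close> the products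
  \<open>decay * c\<close> telescope. The oscillation errors add up to
  \<open>l * Kmax * T * e\<close>, with \<open>e\<close> arbitrarily small by uniform continuity,
  and the quadratic ones to a multiple of \<open>h\<close>.\<close>

lemma noise_sum_tendsto:
  fixes c W :: "real \<Rightarrow> real"
  assumes cont: "continuous_on {0..T} c"
    and sol: "\<And>t. t \<in> {0..T} \<Longrightarrow> c t = c 0 - l * integral {0..t} (\<lambda>s. K s * c s) + \<sigma> * W t"
    and Kc: "(\<lambda>s. K s * c s) integrable_on {0..T}"
  shows "(\<lambda>m. \<Sum>k<Suc m. decay (node T m k) * (\<sigma> * (W (node T m (Suc k)) - W (node T m k))))
    \<longlonglongrightarrow> c T - decay 0 * c 0"
proof (rule LIMSEQ_I)
  fix r :: real assume r: "0 < r"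
  have "bounded (c ` {0..T})"
    by (intro compact_imp_bounded compact_continuous_image cont) auto
  then obtain C where "\<forall>x\<in>c ` {0..T}. norm x \<le> C"
    unfolding bounded_iff by blast
  then have C: "\<And>t. t \<in> {0..T} \<Longrightarrow> \<bar>c t\<bar> \<le> C"
    by simp
  have C0: "0 \<le> C" using C[of 0] T_pos by auto
  define A where "A = l * Kmax * T"
  define B where "B = C * ((l * Kmax)\<^sup>2 * exp (l * Kmax * T)) * T"
  have A0: "0 \<le> A" using l_nonneg Kmax_nonneg T_pos by (simp add: A_def)
  \<comment> \<open>The \<open>+ 1\<close> keeps the denominator positive when \<open>A = 0\<close>
    and makes \<open>A * e < r / 2\<close> strict.\<close>
  define e where "e = r / (2 * (A + 1))"
  have e0: "0 < e" using r A0 by (simp add: e_def)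
  have Ae: "A * e < r / 2" using r A0 by (simp add: e_def field_simps)
  have "uniformly_continuous_on {0..T} c"
    by (intro compact_uniformly_continuous cont) auto
  then obtain d where d: "0 < d"
      "\<And>s t. s \<in> {0..T} \<Longrightarrow> t \<in> {0..T} \<Longrightarrow> dist s t < d \<Longrightarrow> dist (c s) (c t) < e"
    using e0 unfolding uniformly_continuous_on_def by metis
  have lim: "(\<lambda>m. T / real (Suc m)) \<longlonglongrightarrow> 0" by (intro LIMSEQ_Suc lim_const_over_n)
  have "\<forall>\<^sub>F m in sequentially. T / real (Suc m) < d"
    by (rule order_tendstoD(2)[OF lim]) (use d in auto)
  moreover have "\<forall>\<^sub>F m in sequentially. B * (T / real (Suc m)) < r / 2"
    by (rule order_tendstoD(2)[OF tendsto_mult_right_zero[OF lim]]) (use r in auto)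
  ultimately have "\<forall>\<^sub>F m in sequentially. norm ((\<Sum>k<Suc m. decay (node T m k)
      * (\<sigma> * (W (node T m (Suc k)) - W (node T m k)))) - (c T - decay 0 * c 0)) < r"
  proof eventually_elim
    case (elim m)
    define h where "h = T / real (Suc m)"
    have h0: "0 < h" using T_pos by (simp add: h_def)
    let ?t = "node T m"
    have step: "\<bar>decay (?t k) * (\<sigma> * (W (?t (Suc k)) - W (?t k)))
          - (decay (?t (Suc k)) * c (?t (Suc k)) - decay (?t k) * c (?t k))\<bar>
        \<le> l * Kmax * e * h + C * ((l * Kmax * h)\<^sup>2 * exp (l * Kmax * T))" if k: "k < Suc m" for k
    proof -
      have kn: "?t k \<in> {0..T}" "?t (Suc k) \<in> {0..T}"
        using k T_pos node_in[of T k m] node_in[of T "Suc k" m] by simp_all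
      have hk: "?t (Suc k) - ?t k = h" by (simp add: node_Suc h_def)
      have osc: "\<bar>c s - c (?t (Suc k))\<bar> \<le> e" if s: "s \<in> {?t k..?t (Suc k)}" for s
      proof -
        have "dist s (?t (Suc k)) < d" using s hk elim(1) by (auto simp: dist_real_def h_def)
        moreover have "s \<in> {0..T}" using s kn by auto
        ultimately show ?thesis using d(2)[of s "?t (Suc k)"] kn by (auto simp: dist_real_def)
      qed
      show ?thesis
        unfolding hk[symmetric]
        by (rule solution_step_error[OF sol Kc]) (use kn h0 hk osc C e0 in auto)
    qed
    define \<epsilon> where "\<epsilon> = l * Kmax * e * h + C * ((l * Kmax * h)\<^sup>2 * exp (l * Kmax * T))"
    \<comment> \<open>Writing the limit as a telescoping sum turns the total error into a sum of
      step errors.\<close>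
    have total: "(\<Sum>k<Suc m. decay (?t k) * (\<sigma> * (W (?t (Suc k)) - W (?t k)))) - (c T - decay 0 * c 0)
      = (\<Sum>k<Suc m. decay (?t k) * (\<sigma> * (W (?t (Suc k)) - W (?t k)))
          - (decay (?t (Suc k)) * c (?t (Suc k)) - decay (?t k) * c (?t k)))"
      unfolding sum_subtractf[of "\<lambda>k. decay (?t k) * (\<sigma> * (W (?t (Suc k)) - W (?t k)))"]
      by (simp only: sum_node_increments[of "\<lambda>t. decay t * c t"] decay_end mult_1)
    have "real (Suc m) * \<epsilon>
        = (real (Suc m) * h) * (l * Kmax * e + C * ((l * Kmax)\<^sup>2 * exp (l * Kmax * T)) * h)"
    proof -
      have "x * (p * e * h + C * ((p * h)\<^sup>2 * q)) = (x * h) * (p * e + C * (p\<^sup>2 * q) * h)"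
        for x p q :: real
        by (simp add: power2_eq_square algebra_simps)
      then show ?thesis unfolding \<epsilon>_def .
    qed
    also have "real (Suc m) * h = T" by (simp add: h_def)
    also have "T * (l * Kmax * e + C * ((l * Kmax)\<^sup>2 * exp (l * Kmax * T)) * h) = A * e + B * h"
      by (simp add: A_def B_def algebra_simps)
    finally have "real (Suc m) * \<epsilon> < r" using Ae elim(2) unfolding h_def by linarith
    moreover have "norm ((\<Sum>k<Suc m. decay (?t k) * (\<sigma> * (W (?t (Suc k)) - W (?t k))))
        - (c T - decay 0 * c 0)) \<le> (\<Sum>k<Suc m. \<epsilon>)"
      unfolding total
      by (rule order_trans[OF norm_sum], rule sum_mono)
        (use step in \<open>simp add: \<epsilon>_def del: sum.lessThan_Suc\<close>)
    ultimately show ?case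
      unfolding sum_constant card_lessThan by linarith
  qed
  then show "\<exists>no. \<forall>m\<ge>no. norm ((\<Sum>k<Suc m. decay (node T m k)
      * (\<sigma> * (W (node T m (Suc k)) - W (node T m k)))) - (c T - decay 0 * c 0)) < r"
    by (simp add: eventually_sequentially)
qed

end

section \<open>Normal limits and Brownian increments\<close>

text \<open>Rescaling by \<open>\<sigma>\<close> reduces to the known characteristic function of the
  standard normal law.\<close>

lemma (in prob_space) expectation_iexp_normal:
  assumes \<sigma>: "0 < \<sigma>" and X: "distributed M lborel X (normal_density 0 \<sigma>)"
  shows "expectation (\<lambda>\<omega>. iexp (\<theta> * X \<omega>)) = exp (- ((\<sigma> * \<theta>)\<^sup>2) / 2)"
proof -
  have [measurable]: "random_variable borel X"
    using distributed_measurable[OF X] by simp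
  have Y: "distributed M lborel (\<lambda>\<omega>. X \<omega> / \<sigma>) std_normal_density"
    using X normal_standard_normal_convert[OF \<sigma>, of X 0] by simp
  have "expectation (\<lambda>\<omega>. iexp (\<theta> * X \<omega>)) = expectation (\<lambda>\<omega>. iexp ((\<sigma> * \<theta>) * (X \<omega> / \<sigma>)))"
    using \<sigma> by (simp add: field_simps)
  also have "\<dots> = (CLINT y | distr M lborel (\<lambda>\<omega>. X \<omega> / \<sigma>). iexp ((\<sigma> * \<theta>) * y))"
    by (subst integral_distr) simp_all
  also have "\<dots> = char std_normal_distribution (\<sigma> * \<theta>)"
    unfolding distributed_distr_eq_density[OF Y] by (simp add: char_def)
  finally show ?thesis by (simp add: char_std_normal_distribution)
qed

text \<open>The characteristic functions of \<open>X n\<close> converge to that of \<open>Y\<close>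
  by dominated convergence, since \<open>iexp\<close> has modulus 1, and to the normal one by the
  explicit formula; Levy uniqueness identifies the law.\<close>

lemma (in prob_space) distributed_normal_limit:
  assumes s: "\<And>n. 0 < s n" and X: "\<And>n. distributed M lborel (X n) (normal_density 0 (s n))"
    and lim_s: "s \<longlonglongrightarrow> \<sigma>" and \<sigma>: "0 < \<sigma>"
    and lim_X: "AE \<omega> in M. (\<lambda>n. X n \<omega>) \<longlonglongrightarrow> Y \<omega>"
    and [measurable]: "random_variable borel Y"
  shows "distributed M lborel Y (normal_density 0 \<sigma>)"
proof -
  have [measurable]: "random_variable borel (X n)" for n
    using distributed_measurable[OF X] by simp
  let ?N = "density lborel (normal_density 0 \<sigma>)"
  interpret N: prob_space ?N by (rule prob_space_normal_density[OF \<sigma>])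
  have char_Y: "expectation (\<lambda>\<omega>. iexp (\<theta> * Y \<omega>)) = exp (- ((\<sigma> * \<theta>)\<^sup>2) / 2)" for \<theta>
  proof (rule LIMSEQ_unique)
    show "(\<lambda>n. expectation (\<lambda>\<omega>. iexp (\<theta> * X n \<omega>))) \<longlonglongrightarrow> expectation (\<lambda>\<omega>. iexp (\<theta> * Y \<omega>))"
    proof (rule integral_dominated_convergence[where w="\<lambda>_. 1"])
      show "AE \<omega> in M. (\<lambda>n. iexp (\<theta> * X n \<omega>)) \<longlonglongrightarrow> iexp (\<theta> * Y \<omega>)"
        using lim_X by eventually_elim (auto intro!: tendsto_intros)
    qed auto
    show "(\<lambda>n. expectation (\<lambda>\<omega>. iexp (\<theta> * X n \<omega>))) \<longlonglongrightarrow> exp (- ((\<sigma> * \<theta>)\<^sup>2) / 2)"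
      unfolding expectation_iexp_normal[OF s X]
      by (intro tendsto_intros lim_s) auto
  qed
  have "distr M borel Y = ?N"
  proof (rule Levy_uniqueness)
    show "real_distribution (distr M borel Y)"
      by (rule real_distribution_distr) simp
    show "real_distribution ?N"
      by unfold_locales simp
    \<comment> \<open>Under \<open>?N\<close> the identity is itself a normal variable, so
      \<open>expectation_iexp_normal\<close>, read inside \<open>?N\<close>, computes the
      characteristic function of \<open>?N\<close>.\<close>
    have "distributed ?N lborel (\<lambda>x. x) (normal_density 0 \<sigma>)"
      unfolding distributed_def by (auto intro!: distr_id2)
    note char_N = N.expectation_iexp_normal[OF \<sigma> this]
    show "char (distr M borel Y) = char ?N"
    proof
      fix \<theta>
      have "char (distr M borel Y) \<theta> = expectation (\<lambda>\<omega>. iexp (\<theta> * Y \<omega>))"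
        unfolding char_def by (rule integral_distr) simp_all
      then show "char (distr M borel Y) \<theta> = char ?N \<theta>"
        unfolding char_Y char_def[of ?N] char_N .
    qed
  qed
  then show ?thesis
    unfolding distributed_def by (auto cong: distr_cong)
qed

text \<open>Independence factorizes the expectation of the product, so the mixed terms of the second
  moment and of the squared mean cancel.\<close>

lemma (in prob_space) variance_linear_combination_indep:
  assumes indep: "indep_var borel X borel Y"
    and X2: "integrable M (\<lambda>\<omega>. (X \<omega>)\<^sup>2)" and Y2: "integrable M (\<lambda>\<omega>. (Y \<omega>)\<^sup>2)"
  shows "variance (\<lambda>\<omega>. a * X \<omega> + Y \<omega> :: real) = a\<^sup>2 * variance X + variance Y"
proof -
  have [measurable]: "random_variable borel X" "random_variable borel Y"
    using indep_var_rv1[OF indep] indep_var_rv2[OF indep] by auto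
  have [simp]: "integrable M X" "integrable M Y"
    using X2 Y2 by (auto intro: square_integrable_imp_integrable)
  note [simp] = X2 Y2 indep_var_integrable[OF indep] indep_var_lebesgue_integral[OF indep]
  have sq: "(a * X \<omega> + Y \<omega>)\<^sup>2 = a\<^sup>2 * (X \<omega>)\<^sup>2 + 2 * a * (X \<omega> * Y \<omega>) + (Y \<omega>)\<^sup>2" for \<omega>
    by (simp add: power2_eq_square algebra_simps)
  have EX: "expectation (\<lambda>\<omega>. a * X \<omega> + Y \<omega>) = a * expectation X + expectation Y"
    by simp
  have EX2: "expectation (\<lambda>\<omega>. (a * X \<omega> + Y \<omega>)\<^sup>2)
      = a\<^sup>2 * expectation (\<lambda>\<omega>. (X \<omega>)\<^sup>2) + 2 * a * (expectation X * expectation Y)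
        + expectation (\<lambda>\<omega>. (Y \<omega>)\<^sup>2)"
    by (simp add: sq)
  have vars: "variance X = expectation (\<lambda>\<omega>. (X \<omega>)\<^sup>2) - (expectation X)\<^sup>2"
    "variance Y = expectation (\<lambda>\<omega>. (Y \<omega>)\<^sup>2) - (expectation Y)\<^sup>2"
    by (simp_all add: variance_eq)
  have "variance (\<lambda>\<omega>. a * X \<omega> + Y \<omega>)
      = expectation (\<lambda>\<omega>. (a * X \<omega> + Y \<omega>)\<^sup>2) - (expectation (\<lambda>\<omega>. a * X \<omega> + Y \<omega>))\<^sup>2"
    by (rule variance_eq) (simp_all add: sq)
  then show ?thesis
    unfolding EX EX2 vars by (simp add: power2_sum power_mult_distrib algebra_simps)
qed

text \<open>Scaled increments over successive intervals are independent centred normals, so their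
  variances add. Positive weights keep every summand nondegenerate, so that it has a
  density.\<close>

lemma (in brownian_motion) distributed_weighted_increments:
  fixes a t :: "nat \<Rightarrow> real"
  assumes t: "\<And>i. i \<le> Suc m \<Longrightarrow> t i \<in> {0..T}" "\<And>i. i < Suc m \<Longrightarrow> t i < t (Suc i)"
    and a: "\<And>i. i < Suc m \<Longrightarrow> 0 < a i"
  shows "distributed M lborel (\<lambda>\<omega>. \<Sum>i<Suc m. a i * (W (t (Suc i)) \<omega> - W (t i) \<omega>))
    (normal_density 0 (sqrt (\<Sum>i<Suc m. (a i)\<^sup>2 * (t (Suc i) - t i))))"
proof -
  have "indep_vars (\<lambda>_. borel) (\<lambda>i \<omega>. W (t (Suc i)) \<omega> - W (t i) \<omega>) {..<Suc m}"
    by (rule indep_increments) (use t in auto)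
  then have indep: "indep_vars (\<lambda>_. borel) (\<lambda>i \<omega>. a i * (W (t (Suc i)) \<omega> - W (t i) \<omega>)) {..<Suc m}"
    by (rule indep_vars_compose2) simp
  have normal: "distributed M lborel (\<lambda>\<omega>. a i * (W (t (Suc i)) \<omega> - W (t i) \<omega>))
      (normal_density 0 (a i * sqrt (t (Suc i) - t i)))" if i: "i < Suc m" for i
  proof -
    have "distributed M lborel (\<lambda>\<omega>. W (t (Suc i)) \<omega> - W (t i) \<omega>)
        (normal_density 0 (sqrt (t (Suc i) - t i)))"
      using t(1)[of i] t(1)[of "Suc i"] t(2)[of i] i by (intro normal_increments) auto
    from normal_density_affine[OF this, of "a i" 0] a[OF i] t(2)[OF i] show ?thesis
      by simp
  qed
  have "distributed M lborel (\<lambda>\<omega>. \<Sum>i<Suc m. a i * (W (t (Suc i)) \<omega> - W (t i) \<omega>))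
      (normal_density (\<Sum>i<Suc m. 0) (sqrt (\<Sum>i<Suc m. (a i * sqrt (t (Suc i) - t i))\<^sup>2)))"
    using a t(2) by (intro sum_indep_normal indep normal) auto
  also have "(\<Sum>i<Suc m. (a i * sqrt (t (Suc i) - t i))\<^sup>2) = (\<Sum>i<Suc m. (a i)\<^sup>2 * (t (Suc i) - t i))"
    by (intro sum.cong) (auto simp: power_mult_distrib less_imp_le[OF t(2)])
  finally show ?thesis by simp
qed

section \<open>The terminal variance\<close>

text \<open>A continuous \<open>f\<close> is bounded on the compact interval, so the product is
  bounded and measurable on a set of finite measure. The end \<open>b'\<close> varies because the
  integral equation involves every \<open>{0..t}\<close>.\<close>

lemma integrable_bounded_times_continuous:
  fixes K f :: "real \<Rightarrow> real"
  assumes K: "K \<in> borel_measurable (lebesgue_on {a..b})"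
    and K_bound: "\<And>t. t \<in> {a..b} \<Longrightarrow> \<bar>K t\<bar> \<le> B"
    and f: "continuous_on {a..b} f" and b': "b' \<le> b"
  shows "integrable (lebesgue_on {a..b'}) (\<lambda>s. K s * f s)"
proof -
  have sub: "{a..b'} \<subseteq> {a..b}" using b' by auto
  have "bounded (f ` {a..b})"
    by (intro compact_imp_bounded compact_continuous_image f) auto
  then obtain C where "\<forall>x\<in>f ` {a..b}. norm x \<le> C"
    unfolding bounded_iff by blast
  then have C: "\<And>t. t \<in> {a..b} \<Longrightarrow> \<bar>f t\<bar> \<le> C"
    by simp
  show ?thesis
  proof (rule measurable_bounded_by_integrable_imp_lebesgue_integrable)
    have "K \<in> borel_measurable (lebesgue_on {a..b'})"
      by (rule measurable_restrict_mono[OF K sub])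
    moreover have "f \<in> borel_measurable (lebesgue_on {a..b'})"
      by (intro continuous_imp_measurable_on_sets_lebesgue continuous_on_subset[OF f sub]) auto
    ultimately show "(\<lambda>s. K s * f s) \<in> borel_measurable (lebesgue_on {a..b'})"
      by (rule borel_measurable_times)
    show "integrable (lebesgue_on {a..b'}) (\<lambda>_. B * C)"
      by (auto intro!: integrable_const finite_measureI simp: emeasure_restrict_space)
    fix s assume "s \<in> {a..b'}"
    then have "s \<in> {a..b}" using b' by auto
    from K_bound[OF this] C[OF this] show "norm (K s * f s) \<le> B * C"
      unfolding real_norm_def abs_mult by (intro mult_mono) auto
  qed auto
qed

text \<open>With \<open>f\<close> a path of \<open>c\<close> this covers the drift, with the
  constant 1 the schedule itself. It allows passing from the Lebesgue integrals of the definitions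
  to the gauge integrals of the estimates.\<close>

lemma admissible_integrable:
  assumes "admissible T Kmax S K" "continuous_on {0..T} f" "t \<le> T"
  shows "integrable (lebesgue_on {0..t}) (\<lambda>s. K s * f s)"
  using assms
  by (intro integrable_bounded_times_continuous[where b=T and B=Kmax]) (auto simp: admissible_def)

lemma admissible_bounded_schedule:
  assumes "admissible T Kmax S K" "0 < T" "0 \<le> l"
  shows "bounded_schedule T Kmax l K"
proof
  show "K integrable_on {0..T}"
    using integrable_on_lebesgue_on[OF admissible_integrable[OF assms(1), of "\<lambda>_. 1" T]] by auto
qed (use assms in \<open>auto simp: admissible_def\<close>)

lemma admissible_integral:
  assumes "admissible T Kmax S K"
  shows "integral {0..T} K = S"
  using assms lebesgue_integral_eq_integral[OF admissible_integrable[OF assms, of "\<lambda>_. 1" T]]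
  by (auto simp: admissible_def)

text \<open>Almost surely \<open>c T = decay 0 * c 0 + Y\<close>, where \<open>Y\<close> is the
  limit of the noise sums, centred normal with variance \<open>2 * D * I\<close> and independent of
  \<open>c 0\<close>; hence the two variances add.\<close>

lemma (in driven_mode) variance_terminal:
  assumes adm: "admissible T Kmax S K" and T: "0 < T" and l: "0 \<le> l" and D: "0 < D"
  shows "variance (c T) = (bounded_schedule.decay T l K 0)\<^sup>2 * variance (c 0)
    + 2 * D * integral {0..T} (\<lambda>u. (bounded_schedule.decay T l K u)\<^sup>2)"
proof -
  interpret bounded_schedule T Kmax l K
    by (rule admissible_bounded_schedule[OF adm T l])
  let ?t = "node T"
  have t_in: "?t m k \<in> {0..T}" if "k \<le> Suc m" for m k
    using node_in[of T k m] that T by auto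
  define X where "X m \<omega> = (\<Sum>k<Suc m. decay (?t m k)
      * (sqrt (2 * D) * (W (?t m (Suc k)) \<omega> - W (?t m k) \<omega>)))" for m \<omega>
  \<comment> \<open>Taking the limit of the sums, rather than \<open>c T - decay 0 * c 0\<close>,
    makes \<open>Y\<close> a function of the path of \<open>W\<close> at every
    \<open>\<omega>\<close>, as independence of \<open>c 0\<close> requires. Where the sums diverge,
    on a null set only, \<open>lim\<close> is some unspecified value.\<close>
  define Y where "Y \<omega> = lim (\<lambda>m. X m \<omega>)" for \<omega>
  define I where "I = integral {0..T} (\<lambda>u. (decay u)\<^sup>2)"
  define q where "q m = (\<Sum>k<Suc m. (decay (?t m k))\<^sup>2 * (T / real (Suc m)))" for m

  have cont_sq: "continuous_on {0..T} (\<lambda>u. (decay u)\<^sup>2)"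
    by (intro continuous_intros continuous_on_decay)
  have q: "q \<longlonglongrightarrow> I"
    unfolding q_def I_def
    by (intro riemann_sum_mono_tendsto integrable_continuous_real cont_sq)
      (use T in \<open>auto intro!: mono_onI power_mono decay_mono less_imp_le[OF decay_pos]\<close>)
  have q_pos: "0 < q m" for m
    unfolding q_def using T by (intro sum_pos mult_pos_pos zero_less_power decay_pos) auto
  \<comment> \<open>\<open>decay\<close> is smallest at 0, which bounds \<open>I\<close> below; the
    limit law must be nondegenerate to have a normal density.\<close>
  have "integral {0..T} (\<lambda>u. (decay 0)\<^sup>2) \<le> I"
    unfolding I_def
    by (intro integral_le integrable_continuous_real cont_sq)
      (auto intro!: power_mono decay_mono less_imp_le[OF decay_pos])
  moreover have "0 < T * (decay 0)\<^sup>2" by (intro mult_pos_pos zero_less_power decay_pos T)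
  ultimately have I_pos: "0 < I" using T by simp

  have normal_X: "distributed M lborel (X m) (normal_density 0 (sqrt (2 * D * q m)))" for m
  proof -
    have step: "?t m (Suc k) - ?t m k = T / real (Suc m)" for k by (simp add: node_Suc)
    have "distributed M lborel
        (\<lambda>\<omega>. \<Sum>k<Suc m. (sqrt (2 * D) * decay (?t m k)) * (W (?t m (Suc k)) \<omega> - W (?t m k) \<omega>))
        (normal_density 0 (sqrt (\<Sum>k<Suc m. (sqrt (2 * D) * decay (?t m k))\<^sup>2
          * (?t m (Suc k) - ?t m k))))"
      by (rule distributed_weighted_increments)
        (use T D in \<open>auto simp: node_Suc decay_pos simp del: atLeastAtMost_iff intro!: t_in\<close>)
    also have "(\<Sum>k<Suc m. (sqrt (2 * D) * decay (?t m k))\<^sup>2 * (?t m (Suc k) - ?t m k)) = 2 * D * q m"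
      unfolding step q_def sum_distrib_left using D by (simp add: power_mult_distrib mult.assoc)
    also have "(\<lambda>\<omega>. \<Sum>k<Suc m. (sqrt (2 * D) * decay (?t m k))
        * (W (?t m (Suc k)) \<omega> - W (?t m k) \<omega>)) = X m"
      by (simp add: X_def mult_ac fun_eq_iff del: sum.lessThan_Suc)
    finally show ?thesis .
  qed

  \<comment> \<open>On almost every path the equation is deterministic, so the pathwise limit
    applies once Lebesgue integrals are rewritten as gauge integrals.\<close>
  have AE_lim: "AE \<omega> in M. (\<lambda>m. X m \<omega>) \<longlonglongrightarrow> c T \<omega> - decay 0 * c 0 \<omega>"
    using continuous_c solution
  proof eventually_elim
    case (elim \<omega>)
    have int: "integrable (lebesgue_on {0..t}) (\<lambda>s. K s * c s \<omega>)" if "t \<le> T" for t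
      by (rule admissible_integrable[OF adm elim(1) that])
    show ?case unfolding X_def
    proof (rule noise_sum_tendsto[OF elim(1)])
      show "(\<lambda>s. K s * c s \<omega>) integrable_on {0..T}"
        using int[of T] by (auto intro: integrable_on_lebesgue_on)
      show "c t \<omega> = c 0 \<omega> - l * integral {0..t} (\<lambda>s. K s * c s \<omega>) + sqrt (2 * D) * W t \<omega>"
        if t: "t \<in> {0..T}" for t
      proof -
        have "(\<integral>s. K s * c s \<omega> \<partial>lebesgue_on {0..t}) = integral {0..t} (\<lambda>s. K s * c s \<omega>)"
          using t by (intro lebesgue_integral_eq_integral int) auto
        then show ?thesis using bspec[OF elim(2) t] by (simp only:)
      qed
    qed
  qed
  have AE_Y: "AE \<omega> in M. c T \<omega> = decay 0 * c 0 \<omega> + Y \<omega>"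
    using AE_lim by eventually_elim (auto simp: Y_def limI)
  have AE_lim_Y: "AE \<omega> in M. (\<lambda>m. X m \<omega>) \<longlonglongrightarrow> Y \<omega>"
    using AE_lim by eventually_elim (auto simp: Y_def limI)

  \<comment> \<open>\<open>path\<close> and \<open>P\<close> reproduce the path map and the
    sigma-algebra of \<open>indep_start\<close>.\<close>
  define path where "path = (\<lambda>\<omega>. \<lambda>t\<in>{0..T}. W t \<omega>)"
  define P where "P = vimage_algebra (space M) path (Pi\<^sub>M {0..T} (\<lambda>_. borel :: real measure))"
  have path: "path \<in> measurable P (Pi\<^sub>M {0..T} (\<lambda>_. borel))"
    unfolding P_def by (rule measurable_vimage_algebra1) (auto simp: path_def space_PiM)
  have W_P: "W t \<in> borel_measurable P" if "t \<in> {0..T}" for t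
    using measurable_compose[OF path measurable_component_singleton[OF that]] that
    by (simp add: path_def)
  \<comment> \<open>Each sum reads finitely many coordinates of the path; measurability in
    \<open>P\<close> then passes to the limit \<open>Y\<close>.\<close>
  have X_P: "X m \<in> borel_measurable P" for m
    unfolding X_def
    by (intro borel_measurable_sum borel_measurable_times borel_measurable_diff
        borel_measurable_const W_P t_in) auto
  have Y_P: "Y \<in> borel_measurable P"
    unfolding Y_def by (intro borel_measurable_lim_metric X_P)
  have [measurable]: "random_variable borel (X m)" for m
    using distributed_measurable[OF normal_X] by simp
  have Y_M [measurable]: "random_variable borel Y"
    unfolding Y_def by measurable
  have c_M [measurable]: "random_variable borel (c 0)" "random_variable borel (c T)"
    using T by (auto intro: measurable_c)

  have indep: "indep_var borel (c 0) borel Y"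
    unfolding indep_var_eq
  proof (intro conjI c_M Y_M)
    \<comment> \<open>The events of \<open>Y\<close> form a sub-sigma-algebra of \<open>P\<close>,
      and independence is inherited by smaller families.\<close>
    have "sigma_sets (space M) {Y -` A \<inter> space M |A. A \<in> sets borel} \<subseteq> sets P"
      using sets.sigma_sets_subset[of "{Y -` A \<inter> space M |A. A \<in> sets borel}" P]
        measurable_sets[OF Y_P] by (auto simp: P_def)
    then show "indep_set (sigma_sets (space M) {c 0 -` A \<inter> space M |A. A \<in> sets borel})
        (sigma_sets (space M) {Y -` A \<inter> space M |A. A \<in> sets borel})"
      using indep_start unfolding indep_set_def path_def[symmetric] P_def[symmetric]
      by (elim indep_sets_mono_sets) (auto simp: sets_vimage_algebra split: bool.split)
  qed

  have normal_Y: "distributed M lborel Y (normal_density 0 (sqrt (2 * D * I)))"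
    by (rule distributed_normal_limit[OF _ normal_X _ _ AE_lim_Y Y_M])
      (use D q_pos I_pos in \<open>auto intro!: tendsto_intros q\<close>)
  have sd_pos: "0 < sqrt (2 * D * I)" using D I_pos by simp
  have "integrable M (\<lambda>\<omega>. (Y \<omega>)\<^sup>2)"
    using distributed_integrable[OF normal_Y, of "\<lambda>x. x\<^sup>2"] integrable_normal_moment[OF sd_pos, of 0 2]
    by simp
  then have "variance (\<lambda>\<omega>. decay 0 * c 0 \<omega> + Y \<omega>) = (decay 0)\<^sup>2 * variance (c 0) + variance Y"
    by (intro variance_linear_combination_indep indep square_integrable_start)
  also have "variance Y = 2 * D * I"
    using normal_distributed_variance[OF sd_pos normal_Y] D I_pos by simp
  also have "variance (\<lambda>\<omega>. decay 0 * c 0 \<omega> + Y \<omega>) = variance (c T)"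
  proof -
    have "expectation (\<lambda>\<omega>. decay 0 * c 0 \<omega> + Y \<omega>) = expectation (c T)"
      using AE_Y by (intro integral_cong_AE) auto
    then show ?thesis
      using AE_Y by (intro integral_cong_AE) auto
  qed
  finally show ?thesis by (simp add: I_def)
qed

section \<open>Optimality of the terminal bang-bang schedule\<close>

context
  fixes T Kmax S \<kappa> :: real
  assumes T: "0 < T" and Kmax: "0 < Kmax" and S: "0 \<le> S" "S \<le> Kmax * T"
begin

lemma switching_time: "0 \<le> T - S / Kmax" "T - S / Kmax \<le> T"
  using Kmax S by (auto simp: divide_le_eq mult.commute)

lemma terminal_bang_bang_has_integral_before:
  assumes "b \<le> T - S / Kmax"
  shows "(terminal_bang_bang T Kmax S \<kappa> has_integral 0) {a..b}"
  by (rule has_integral_spike_finite[of "{T - S / Kmax}" _ _ "\<lambda>_. 0"])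
    (use assms in \<open>auto simp: terminal_bang_bang_def\<close>)

lemma terminal_bang_bang_has_integral_after:
  assumes "T - S / Kmax \<le> a" "a \<le> b"
  shows "(terminal_bang_bang T Kmax S \<kappa> has_integral Kmax * (b - a)) {a..b}"
proof (rule has_integral_spike_finite[of "{T - S / Kmax}" _ _ "\<lambda>_. Kmax"])
  show "((\<lambda>_. Kmax) has_integral Kmax * (b - a)) {a..b}"
    using has_integral_const_real[of Kmax a b] assms by (simp add: mult.commute)
qed (use assms in \<open>auto simp: terminal_bang_bang_def\<close>)

lemma terminal_bang_bang_has_integral:
  "(terminal_bang_bang T Kmax S \<kappa> has_integral S) {0..T}"
proof -
  \<comment> \<open>Full rate over the last \<open>S / Kmax\<close> units of time delivers exactly
    \<open>S\<close>.\<close>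
  have "(terminal_bang_bang T Kmax S \<kappa> has_integral 0 + Kmax * (T - (T - S / Kmax))) {0..T}"
    by (rule has_integral_combine[OF switching_time terminal_bang_bang_has_integral_before
          terminal_bang_bang_has_integral_after]) (use switching_time in auto)
  then show ?thesis using Kmax by simp
qed

lemma admissible_terminal_bang_bang:
  assumes "0 \<le> \<kappa>" "\<kappa> \<le> Kmax"
  shows "admissible T Kmax S (terminal_bang_bang T Kmax S \<kappa>)"
proof -
  have "terminal_bang_bang T Kmax S \<kappa> \<in> borel_measurable borel"
    unfolding terminal_bang_bang_def[abs_def] by measurable
  then have meas: "terminal_bang_bang T Kmax S \<kappa> \<in> borel_measurable (lebesgue_on {0..T})"
    by (intro measurable_restrict_space1 measurable_completion) simp
  have bounds: "0 \<le> terminal_bang_bang T Kmax S \<kappa> t" "terminal_bang_bang T Kmax S \<kappa> t \<le> Kmax" for t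
    using assms Kmax by (auto simp: terminal_bang_bang_def)
  have "integrable (lebesgue_on {0..T}) (\<lambda>t. terminal_bang_bang T Kmax S \<kappa> t * 1)"
    by (rule integrable_bounded_times_continuous[OF meas, where B=Kmax]) (use bounds in auto)
  then have "(\<integral>t. terminal_bang_bang T Kmax S \<kappa> t \<partial>lebesgue_on {0..T}) = S"
    using terminal_bang_bang_has_integral
    by (subst lebesgue_integral_eq_integral) (auto intro: integral_unique)
  with meas bounds show ?thesis by (auto simp: admissible_def)
qed

text \<open>Two bounds hold for any tail: the whole budget \<open>S\<close>, as the amount spent
  before \<open>t\<close> is nonnegative, and the full rate \<open>Kmax * (T - t)\<close>. The
  bang-bang schedule attains the first up to the switching time and the second after it.\<close>

lemma integral_le_terminal_bang_bang:
  assumes K: "admissible T Kmax S K" and t: "t \<in> {0..T}"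
  shows "integral {t..T} K \<le> integral {t..T} (terminal_bang_bang T Kmax S \<kappa>)"
proof -
  \<comment> \<open>The rate 0 is a placeholder: only the bounds on integrals of \<open>K\<close>
    are wanted here.\<close>
  interpret bounded_schedule T Kmax 0 K
    by (rule admissible_bounded_schedule[OF K T]) simp
  show ?thesis
  proof (cases "t \<le> T - S / Kmax")
    case True
    have "integral {t..T} K = S - integral {0..t} K"
      using integral_diff_initial[OF K_integrable, of t T] t admissible_integral[OF K] by simp
    also have "\<dots> \<le> S" using integral_K_nonneg[of 0 t] t by simp
    also have "S = integral {t..T} (terminal_bang_bang T Kmax S \<kappa>)"
    proof -
      have "integral {0..T} (terminal_bang_bang T Kmax S \<kappa>) = S"
        by (rule integral_unique[OF terminal_bang_bang_has_integral])
      moreover have "integral {0..t} (terminal_bang_bang T Kmax S \<kappa>) = 0"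
        by (rule integral_unique[OF terminal_bang_bang_has_integral_before[OF True]])
      ultimately show ?thesis
        using integral_diff_initial[OF has_integral_integrable[OF terminal_bang_bang_has_integral],
            of t T] t by simp
    qed
    finally show ?thesis .
  next
    case False
    then have "integral {t..T} (terminal_bang_bang T Kmax S \<kappa>) = Kmax * (T - t)"
      using t by (intro integral_unique terminal_bang_bang_has_integral_after) auto
    with integral_K_le[of t T] t show ?thesis by simp
  qed
qed

text \<open>Both schedules spend the same total \<open>S\<close>, so the initial terms of the
  variance formula agree, while larger tail integrals make \<open>decay\<close> smaller at every
  time. The two modes may live on different probability spaces; their initial variances link
  them.\<close>

lemma variance_terminal_bang_bang_le:
  assumes D: "0 < D" and l: "0 \<le> l" and \<kappa>: "0 \<le> \<kappa>" "\<kappa> \<le> Kmax"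
    and K: "admissible T Kmax S K"
    and c: "driven_mode M T W D l K c"
    and c': "driven_mode M' T W' D l (terminal_bang_bang T Kmax S \<kappa>) c'"
    and start: "prob_space.variance M' (c' 0) = prob_space.variance M (c 0)"
  shows "prob_space.variance M' (c' T) \<le> prob_space.variance M (c T)"
proof -
  let ?K = "terminal_bang_bang T Kmax S \<kappa>"
  note K' = admissible_terminal_bang_bang[OF \<kappa>]
  interpret A: bounded_schedule T Kmax l K
    by (rule admissible_bounded_schedule[OF K T l])
  interpret B: bounded_schedule T Kmax l ?K
    by (rule admissible_bounded_schedule[OF K' T l])
  have "B.decay t \<le> A.decay t" if "t \<in> {0..T}" for t
    unfolding A.decay_def B.decay_def
    using integral_le_terminal_bang_bang[OF K that] l by (simp add: mult_left_mono)
  then have "integral {0..T} (\<lambda>u. (B.decay u)\<^sup>2) \<le> integral {0..T} (\<lambda>u. (A.decay u)\<^sup>2)"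
    by (intro integral_le integrable_continuous_real continuous_intros
        A.continuous_on_decay B.continuous_on_decay power_mono less_imp_le[OF B.decay_pos])
  then have "2 * D * integral {0..T} (\<lambda>u. (B.decay u)\<^sup>2) \<le> 2 * D * integral {0..T} (\<lambda>u. (A.decay u)\<^sup>2)"
    using D by (intro mult_left_mono) auto
  moreover have "A.decay 0 = B.decay 0"
    by (simp add: A.decay_def B.decay_def admissible_integral[OF K] admissible_integral[OF K'])
  ultimately show ?thesis
    by (simp add: driven_mode.variance_terminal[OF c K T l D]
        driven_mode.variance_terminal[OF c' K' T l D] start)
qed

end

section \<open>All modes above the first and their weighted sums\<close>

theorem proposition3:
  fixes N :: nat and w :: "nat \<Rightarrow> nat \<Rightarrow> real" and lam v\<^sub>0 :: "nat \<Rightarrow> real"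
    and D T Kmax S\<^sub>T \<kappa> :: real
  assumes graph: "weighted_graph N w" "connected_graph N w"
    and eigenvalues: "2 \<le> N" "eigenvalue_list N (laplacian N w) lam" "lam 1 = 0" "0 < lam 2"
    and parameters: "0 < D" "0 < T" "0 < Kmax" "0 \<le> S\<^sub>T" "S\<^sub>T \<le> Kmax * T"
    and switch_value: "0 \<le> \<kappa>" "\<kappa> \<le> Kmax"
    and initial_variances: "\<forall>\<alpha>\<in>{2..N}. 0 \<le> v\<^sub>0 \<alpha>"
  shows "admissible T Kmax S\<^sub>T (terminal_bang_bang T Kmax S\<^sub>T \<kappa>) \<and>
    (\<forall>\<alpha>\<in>{2..N}. \<forall>K (M :: 'a measure) W c (M' :: 'b measure) W' c'.
      admissible T Kmax S\<^sub>T K \<and>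
      driven_mode M T W D (lam \<alpha>) K c \<and>
      prob_space.variance M (c 0) = v\<^sub>0 \<alpha> \<and>
      driven_mode M' T W' D (lam \<alpha>) (terminal_bang_bang T Kmax S\<^sub>T \<kappa>) c' \<and>
      prob_space.variance M' (c' 0) = v\<^sub>0 \<alpha> \<longrightarrow>
      prob_space.variance M' (c' T) \<le> prob_space.variance M (c T)) \<and>
    (\<forall>p K (M :: nat \<Rightarrow> 'a measure) W c (M' :: nat \<Rightarrow> 'b measure) W' c'.
      (\<forall>\<alpha>\<in>{2..N}. 0 \<le> p \<alpha>) \<and>
      admissible T Kmax S\<^sub>T K \<and>
      (\<forall>\<alpha>\<in>{2..N}.
        driven_mode (M \<alpha>) T (W \<alpha>) D (lam \<alpha>) K (c \<alpha>) \<and>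
        prob_space.variance (M \<alpha>) (c \<alpha> 0) = v\<^sub>0 \<alpha> \<and>
        driven_mode (M' \<alpha>) T (W' \<alpha>) D (lam \<alpha>) (terminal_bang_bang T Kmax S\<^sub>T \<kappa>) (c' \<alpha>) \<and>
        prob_space.variance (M' \<alpha>) (c' \<alpha> 0) = v\<^sub>0 \<alpha>) \<longrightarrow>
      (\<Sum>\<alpha>=2..N. p \<alpha> * prob_space.variance (M' \<alpha>) (c' \<alpha> T))
        \<le> (\<Sum>\<alpha>=2..N. p \<alpha> * prob_space.variance (M \<alpha>) (c \<alpha> T)))"
proof -
  let ?K = "terminal_bang_bang T Kmax S\<^sub>T \<kappa>"
  have lam: "0 \<le> lam \<alpha>" if "\<alpha> \<in> {2..N}" for \<alpha>
  proof -
    have "mono_on {1..N} lam" using eigenvalues(2) by (simp add: eigenvalue_list_def)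
    then have "lam 2 \<le> lam \<alpha>" by (rule mono_onD) (use that in auto)
    with eigenvalues(4) show ?thesis by simp
  qed
  note le = variance_terminal_bang_bang_le[OF parameters(2-5,1) lam switch_value]
  show ?thesis
  proof (intro conjI ballI allI impI)
    show "admissible T Kmax S\<^sub>T ?K"
      by (rule admissible_terminal_bang_bang[OF parameters(2-5) switch_value])
  next
    fix \<alpha> K and M :: "'a measure" and W c and M' :: "'b measure" and W' c'
    assume \<alpha>: "\<alpha> \<in> {2..N}"
      and H: "admissible T Kmax S\<^sub>T K \<and> driven_mode M T W D (lam \<alpha>) K c \<and>
        prob_space.variance M (c 0) = v\<^sub>0 \<alpha> \<and> driven_mode M' T W' D (lam \<alpha>) ?K c' \<and>
        prob_space.variance M' (c' 0) = v\<^sub>0 \<alpha>"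
    show "prob_space.variance M' (c' T) \<le> prob_space.variance M (c T)"
      by (rule le[OF \<alpha>]) (use H in auto)
  next
    fix p :: "nat \<Rightarrow> real" and K and M :: "nat \<Rightarrow> 'a measure" and W c
      and M' :: "nat \<Rightarrow> 'b measure" and W' c'
    assume H: "(\<forall>\<alpha>\<in>{2..N}. 0 \<le> p \<alpha>) \<and> admissible T Kmax S\<^sub>T K \<and>
      (\<forall>\<alpha>\<in>{2..N}. driven_mode (M \<alpha>) T (W \<alpha>) D (lam \<alpha>) K (c \<alpha>) \<and>
        prob_space.variance (M \<alpha>) (c \<alpha> 0) = v\<^sub>0 \<alpha> \<and>
        driven_mode (M' \<alpha>) T (W' \<alpha>) D (lam \<alpha>) ?K (c' \<alpha>) \<and>
        prob_space.variance (M' \<alpha>) (c' \<alpha> 0) = v\<^sub>0 \<alpha>)"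
    show "(\<Sum>\<alpha>=2..N. p \<alpha> * prob_space.variance (M' \<alpha>) (c' \<alpha> T))
        \<le> (\<Sum>\<alpha>=2..N. p \<alpha> * prob_space.variance (M \<alpha>) (c \<alpha> T))"
    \<comment> \<open>Nonnegative weights preserve the inequality of each mode, so no joint law of
      the modes is involved.\<close>
    proof (intro sum_mono mult_left_mono)
      fix \<alpha> assume \<alpha>: "\<alpha> \<in> {2..N}"
      show "0 \<le> p \<alpha>" using H \<alpha> by blast
      show "prob_space.variance (M' \<alpha>) (c' \<alpha> T) \<le> prob_space.variance (M \<alpha>) (c \<alpha> T)"
        by (rule le[OF \<alpha>, where K=K and W="W \<alpha>" and W'="W' \<alpha>"]) (use H \<alpha> in auto)
    qed
  qed
qed

end
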